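(* Let $A\in\mathbb{R}^{n\times n}$ be a square non-singular matrix with spectral norm $\gamma=\|A\|$, and let $\lambda_{\min}$ and $\lambda_{\max}$ be the smallest and largest eigenvalues of $AA^T$. For $\eta>0$ let $\rho(\eta)$ be the maximum of $|z|$ over all complex roots $z$ of the characteristic equation of OGDA, $$\det\begin{pmatrix} (z^2-z)\mathbf{I}_n & (2z-1)\eta A\\ -(2z-1)\eta A^T & (z^2-z)\mathbf{I}_n\end{pmatrix} = 0 .$$ Define $r:(0,\infty)\to\mathbb{R}$ by $$r(\lambda) = \frac{\sqrt{2+2\sqrt{1-4\lambda}}}{2} \ \text{ for } 0<\lambda\le \tfrac14, \qquad r(\lambda) = \sqrt{2\lambda+\sqrt{\lambda(4\lambda-1)}} \ \text{ for } \lambda>\tfrac14 .$$ Then the learning rate $\eta_{\mathrm{opt}}>0$ that minimizes $\rho$ over $\eta>0$ is as follows. (i) If $\lambda_{\min}=\lambda_{\max}$, then $\eta_{\mathrm{opt}} = \frac{1}{2\sqrt{\lambda_{\max}}} = \frac{1}{2\gamma}$. (ii) If $\lambda_{\min}\ne\lambda_{\max}$, then $\eta_{\mathrm{opt}}$ is the learning rate satisfying $r(\eta_{\mathrm{opt}}^2\lambda_{\min}) = r(\eta_{\mathrm{opt}}^2\lambda_{\max})$, and it satisfies $\eta_{\mathrm{opt}}^2\lambda_{\min}<\frac14<\eta_{\mathrm{opt}}^2\lambda_{\max}$.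
   Context: OGDA (Optimistic Gradient Descent/Ascent) for the bilinear game $f(\mathbf{x},\mathbf{y})=\mathbf{x}^TA\mathbf{y}$ with learning rate $\eta$ is the recursion $\mathbf{x}_{t+2} = \mathbf{x}_{t+1} - 2\eta A\mathbf{y}_{t+1} + \eta A\mathbf{y}_t$, $\mathbf{y}_{t+2} = \mathbf{y}_{t+1} + 2\eta A^T\mathbf{x}_{t+1} - \eta A^T\mathbf{x}_t$. Its rate of convergence is the largest modulus $\rho(\eta)$ of a root of the characteristic equation. The spectral norm $\|S\|$ is the square root of the largest eigenvalue of $S^TS$. *)

theory Defs
  imports "Jordan_Normal_Form.Spectral_Radius"
begin

text \<open>
  The library constant \<open>spectrum\<close>, used here on real matrices, is the set of real eigenvalues.
  It is only applied to the symmetric matrices \<open>S\<^sup>T * S\<close> and \<open>A * A\<^sup>T\<close>,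
  all of whose eigenvalues are real.
\<close>

definition spectral_norm :: "real mat \<Rightarrow> real" where
  "spectral_norm S = sqrt (Max (spectrum (transpose_mat S * S)))"

definition lambda_min :: "real mat \<Rightarrow> real" where
  "lambda_min A = Min (spectrum (A * transpose_mat A))"

definition lambda_max :: "real mat \<Rightarrow> real" where
  "lambda_max A = Max (spectrum (A * transpose_mat A))"

definition ogda_matrix :: "real mat \<Rightarrow> real \<Rightarrow> complex \<Rightarrow> complex mat" where
  "ogda_matrix A \<eta> z =
    (let n = dim_row A; B = map_mat complex_of_real A in
     four_block_mat
       ((z^2 - z) \<cdot>\<^sub>m 1\<^sub>m n)                                  (((2 * z - 1) * complex_of_real \<eta>) \<cdot>\<^sub>m B)
       ((- (2 * z - 1) * complex_of_real \<eta>) \<cdot>\<^sub>m transpose_mat B)   ((z^2 - z) \<cdot>\<^sub>m 1\<^sub>m n))"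

definition ogda_roots :: "real mat \<Rightarrow> real \<Rightarrow> complex set" where
  "ogda_roots A \<eta> = {z. det (ogda_matrix A \<eta> z) = 0}"

text \<open>
  The determinant is a monic polynomial of degree \<open>4 * n\<close> in \<open>z\<close>, so for \<open>n > 0\<close> the maximum
  is over a finite nonempty set.
\<close>

definition ogda_rate :: "real mat \<Rightarrow> real \<Rightarrow> real" where
  "ogda_rate A \<eta> = Max (cmod ` ogda_roots A \<eta>)"

text \<open>Meaningful for \<open>l > 0\<close> only.\<close>

definition r :: "real \<Rightarrow> real" where
  "r l = (if l \<le> 1 / 4 then sqrt (2 + 2 * sqrt (1 - 4 * l)) / 2
          else sqrt (2 * l + sqrt (l * (4 * l - 1))))"

end

theory Submission
  imports Defs
begin

text \<open>
  The lower two blocks of the characteristic matrix commute, so with \<open>a = z\<^sup>2 - z\<close> and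
  \<open>b = (2 z - 1) \<eta>\<close> its determinant is that of \<open>a\<^sup>2 I + b\<^sup>2 A A\<^sup>T\<close>. Hence the roots are
  those of the quartics \<open>(z\<^sup>2 - z)\<^sup>2 + (2 z - 1)\<^sup>2 \<eta>\<^sup>2 \<mu> = 0\<close>, with \<open>\<mu>\<close> an eigenvalue of
  \<open>A A\<^sup>T\<close>. Such a quartic splits into two quadratics over the complex numbers, and its largest
  root modulus is \<open>r (\<eta>\<^sup>2 \<mu>)\<close>. Since \<open>r\<close> decreases strictly up to \<open>1/4\<close> and increases
  strictly afterwards, only the extreme eigenvalues matter, and the maximum of the two
  corresponding values is smallest exactly where they coincide on opposite sides of \<open>1/4\<close>.
\<close>

section \<open>Monotonicity and continuity of \<open>r\<close>\<close>

text \<open>Both branches of \<open>r\<close> equal \<open>sqrt 2 / 2\<close> at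
  \<open>1 / 4\<close>, so the second formula also covers the closed half-line.\<close>

lemma r_quarter_right:
  assumes "l \<ge> 1 / 4"
  shows "r l = sqrt (2 * l + sqrt (l * (4 * l - 1)))"
proof (cases "l = 1 / 4")
  case True
  have "sqrt (1 / 2 :: real) = sqrt (2 / 2\<^sup>2)" by simp
  also have "\<dots> = sqrt 2 / 2" by (simp only: real_sqrt_divide) simp
  finally show ?thesis unfolding True r_def by simp
next
  case False
  with assms show ?thesis by (simp add: r_def)
qed

lemma r_strict_antimono:
  assumes "x < y" "y \<le> 1 / 4"
  shows "r y < r x"
  using assms by (simp add: r_def)

lemma r_strict_mono:
  assumes "1 / 4 \<le> x" "x < y"
  shows "r x < r y"
proof -
  have "x * (4 * x - 1) < y * (4 * y - 1)"
    using assms by (intro mult_strict_mono) auto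
  then show ?thesis
    using assms by (simp add: r_quarter_right add_strict_mono)
qed

lemma continuous_on_r: "continuous_on UNIV r"
proof -
  have "continuous_on ({..1 / 4} \<union> {1 / 4..}) r"
  proof (rule continuous_on_closed_Un)
    have "continuous_on {..1 / 4} (\<lambda>l :: real. sqrt (2 + 2 * sqrt (1 - 4 * l)) / 2)"
      by (intro continuous_intros) auto
    then show "continuous_on {..1 / 4} r"
      by (rule continuous_on_cong[THEN iffD1, rotated 2]) (auto simp: r_def)
    have "continuous_on {1 / 4..} (\<lambda>l :: real. sqrt (2 * l + sqrt (l * (4 * l - 1))))"
      by (intro continuous_intros)
    then show "continuous_on {1 / 4..} r"
      by (rule continuous_on_cong[THEN iffD1, rotated 2]) (simp_all add: r_quarter_right)
  qed auto
  moreover have "{..1 / 4} \<union> {1 / 4..} = (UNIV :: real set)" by auto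
  ultimately show ?thesis by simp
qed

text \<open>Moving away from \<open>1 / 4\<close> in either direction increases \<open>r\<close>, so
  an intermediate eigenvalue cannot dominate both extreme ones.\<close>

lemma r_le_max:
  assumes "a \<le> x" "x \<le> b"
  shows "r x \<le> max (r a) (r b)"
proof (cases "x \<le> 1 / 4")
  case True
  then have "r x \<le> r a"
    using r_strict_antimono[of a x] assms by (cases "a = x") auto
  then show ?thesis by simp
next
  case False
  then have "r x \<le> r b"
    using r_strict_mono[of x b] assms by (cases "x = b") auto
  then show ?thesis by simp
qed

section \<open>Largest root modulus of the scalar quartic\<close>

text \<open>The sign of \<open>t\<close> is left free so that one bound serves both quadratic
  factors of the quartic.\<close>

lemma quadratic_factor_root_bound:
  fixes z :: complex and t :: real
  assumes eq: "z\<^sup>2 - z = \<i> * of_real t * (2 * z - 1)"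
  shows "cmod z \<le> r (t\<^sup>2)"
proof -
  \<comment> \<open>Completing the square: the quadratic has discriminant \<open>1 - 4 t\<^sup>2\<close>.\<close>
  define w where "w = 2 * z - 1 - 2 * \<i> * of_real t"
  have "w\<^sup>2 = 4 * (z\<^sup>2 - z - \<i> * of_real t * (2 * z - 1)) + 1 - 4 * of_real (t\<^sup>2)"
    by (simp add: w_def power2_eq_square algebra_simps)
  then have w2: "w\<^sup>2 = of_real (1 - 4 * t\<^sup>2)"
    using eq by simp
  have z: "z = (1 + w) / 2 + \<i> * of_real t"
    by (simp add: w_def field_simps)
  show ?thesis
  proof (cases "t\<^sup>2 \<le> 1 / 4")
    case True
    define u where "u = sqrt (1 - 4 * t\<^sup>2)"
    have u: "u\<^sup>2 = 1 - 4 * t\<^sup>2" "u \<ge> 0"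
      using True by (auto simp: u_def)
    have "w\<^sup>2 = (of_real u)\<^sup>2"
      by (simp only: w2 u(1)[symmetric] of_real_power)
    then have "w = of_real u \<or> w = - of_real u"
      by (simp add: power2_eq_iff)
    \<comment> \<open>Here \<open>w\<close> is real, and
      \<open>(1 + w)\<^sup>2 / 4 + t\<^sup>2\<close> collapses to
      \<open>(2 + 2 * w) / 4\<close>.\<close>
    then have "(cmod z)\<^sup>2 \<le> (2 + 2 * u) / 4"
      using u by (auto simp: z cmod_power2) (auto simp: power2_eq_square field_simps)
    then have "cmod z \<le> sqrt ((2 + 2 * u) / 4)"
      by (rule real_le_rsqrt)
    also have "\<dots> = r (t\<^sup>2)"
      using True by (simp add: r_def u_def real_sqrt_divide)
    finally show ?thesis .
  next
    case False
    define u where "u = sqrt (4 * t\<^sup>2 - 1)"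
    have u: "u\<^sup>2 = 4 * t\<^sup>2 - 1" "u \<ge> 0"
      using False by (auto simp: u_def)
    have "w\<^sup>2 = (\<i> * of_real u)\<^sup>2"
      by (simp add: w2 power_mult_distrib u(1) flip: of_real_power)
    then have "w = \<i> * of_real u \<or> w = - (\<i> * of_real u)"
      by (simp add: power2_eq_iff)
    \<comment> \<open>Now \<open>z\<close> has real part \<open>1 / 2\<close>, and its squared
      modulus is \<open>2 * t\<^sup>2\<close> plus or minus \<open>t * u\<close>; the absolute value
      covers both signs.\<close>
    moreover have "t * u \<le> \<bar>t\<bar> * u" "- (t * u) \<le> \<bar>t\<bar> * u"
      using u(2) abs_ge_self[of "t * u"] abs_ge_minus_self[of "t * u"] by (auto simp: abs_mult)
    ultimately have "(cmod z)\<^sup>2 \<le> 2 * t\<^sup>2 + \<bar>t\<bar> * u"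
      using u by (auto simp: z cmod_power2) (auto simp: power2_eq_square field_simps)
    then have "cmod z \<le> sqrt (2 * t\<^sup>2 + \<bar>t\<bar> * u)"
      by (rule real_le_rsqrt)
    also have "\<dots> = r (t\<^sup>2)"
      using False by (simp add: r_def u_def real_sqrt_mult)
    finally show ?thesis .
  qed
qed

text \<open>Over the complex numbers the quartic is a difference of two squares; its factors are the
  quadratics above with \<open>t = sqrt l\<close> and \<open>t = - sqrt l\<close>.\<close>

lemma quartic_root_bound:
  fixes z :: complex
  assumes "l > 0" and eq: "(z\<^sup>2 - z)\<^sup>2 + (2 * z - 1)\<^sup>2 * of_real l = 0"
  shows "cmod z \<le> r l"
proof -
  define s where "s = sqrt l"
  have s: "s\<^sup>2 = l" using assms by (simp add: s_def)
  have "(z\<^sup>2 - z)\<^sup>2 = (\<i> * of_real s * (2 * z - 1))\<^sup>2"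
    using eq by (simp add: power_mult_distrib s eq_neg_iff_add_eq_0 mult.commute flip: of_real_power)
  then consider "z\<^sup>2 - z = \<i> * of_real s * (2 * z - 1)"
    | "z\<^sup>2 - z = - (\<i> * of_real s * (2 * z - 1))"
    unfolding power2_eq_iff by blast
  then show ?thesis
  proof cases
    case 1
    from quadratic_factor_root_bound[OF this] show ?thesis by (simp add: s)
  next
    case 2
    then have "z\<^sup>2 - z = \<i> * of_real (- s) * (2 * z - 1)" by simp
    from quadratic_factor_root_bound[OF this] show ?thesis by (simp add: s)
  qed
qed

text \<open>With \<open>t = sqrt l\<close> nonnegative, the plus sign in the quadratic formula turns
  the upper estimate into an equality.\<close>

lemma quartic_root_attained:
  assumes "l > 0"
  obtains z :: complex
  where "(z\<^sup>2 - z)\<^sup>2 + (2 * z - 1)\<^sup>2 * of_real l = 0" "cmod z = r l"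
proof -
  define s where "s = sqrt l"
  have s: "s\<^sup>2 = l" "s \<ge> 0" using assms by (simp_all add: s_def)
  have root: "(z\<^sup>2 - z)\<^sup>2 + (2 * z - 1)\<^sup>2 * of_real l = 0"
    if z: "z = (1 + w) / 2 + \<i> * of_real s" and w: "w\<^sup>2 = of_real (1 - 4 * l)" for z w
  proof -
    have "4 * (z\<^sup>2 - z - \<i> * of_real s * (2 * z - 1)) = w\<^sup>2 - 1 + 4 * (of_real s)\<^sup>2"
      by (simp add: z power2_eq_square field_simps)
    also have "\<dots> = 0" by (simp add: w s flip: of_real_power)
    \<comment> \<open>Removing the distributive rule keeps the product with \<open>4\<close> intact,
      so that this factor can be cancelled.\<close>
    finally have "z\<^sup>2 - z = \<i> * of_real s * (2 * z - 1)"
      by (simp del: right_diff_distrib_numeral)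
    then show ?thesis by (simp add: power_mult_distrib s mult.commute flip: of_real_power)
  qed
  show thesis
  proof (cases "l \<le> 1 / 4")
    case True
    define u where "u = sqrt (1 - 4 * l)"
    have u: "u\<^sup>2 = 1 - 4 * l" using True by (auto simp: u_def)
    define z where "z = (1 + of_real u) / 2 + \<i> * complex_of_real s"
    have "(cmod z)\<^sup>2 = (2 + 2 * u) / 4"
      using u s(1) by (simp add: z_def cmod_power2) (simp add: power2_eq_square field_simps)
    then have "cmod z = sqrt ((2 + 2 * u) / 4)"
      by (metis norm_ge_zero real_sqrt_unique)
    also have "\<dots> = r l" using True by (simp add: r_def u_def real_sqrt_divide)
    finally show thesis using that root[OF z_def] u by (simp flip: of_real_power)
  next
    case False
    define u where "u = sqrt (4 * l - 1)"
    have u: "u\<^sup>2 = 4 * l - 1" using False by (auto simp: u_def)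
    define z where "z = (1 + \<i> * of_real u) / 2 + \<i> * complex_of_real s"
    have "(cmod z)\<^sup>2 = 2 * l + s * u"
      using u s(1) by (simp add: z_def cmod_power2) (simp add: power2_eq_square field_simps)
    then have "cmod z = sqrt (2 * l + s * u)"
      by (metis norm_ge_zero real_sqrt_unique)
    also have "\<dots> = r l" using False by (simp add: r_def u_def s_def real_sqrt_mult)
    finally show thesis using that root[OF z_def] u by (simp add: power_mult_distrib flip: of_real_power)
  qed
qed

section \<open>Invertibility and the spectrum of the Gram matrix\<close>

lemma invertible_mat_det_nonzero:
  fixes A :: "'a :: idom mat"
  assumes A: "A \<in> carrier_mat n n" and inv: "invertible_mat A"
  shows "det A \<noteq> 0"
proof -
  obtain B where AB: "A * B = 1\<^sub>m (dim_row A)" and BA: "B * A = 1\<^sub>m (dim_row B)"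
    using inv unfolding invertible_mat_def inverts_mat_def by auto
  \<comment> \<open>Invertibility does not fix the shape of \<open>B\<close>; the column counts of
    the two products determine it.\<close>
  have "B \<in> carrier_mat n n"
    using arg_cong[OF AB, of dim_col] arg_cong[OF BA, of dim_col] A by auto
  then have "det A * det B = 1"
    using det_mult[OF A, of B] AB A by simp
  then show ?thesis by auto
qed

text \<open>\<open>Y\<close> maps an eigenvector \<open>v\<close> of \<open>X * Y\<close> to one of
  \<open>Y * X\<close>; the image is nonzero because \<open>X\<close> sends it to a nonzero multiple
  of \<open>v\<close>.\<close>

lemma eigenvalue_mult_commute:
  fixes X Y :: "'a :: field mat"
  assumes X: "X \<in> carrier_mat n n" and Y: "Y \<in> carrier_mat n n"
    and k: "k \<noteq> 0" and ev: "eigenvalue (X * Y) k"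
  shows "eigenvalue (Y * X) k"
proof -
  obtain v where v: "v \<in> carrier_vec n" "v \<noteq> 0\<^sub>v n" "(X * Y) *\<^sub>v v = k \<cdot>\<^sub>v v"
    using ev X Y unfolding eigenvalue_def eigenvector_def by auto
  have XYv: "X *\<^sub>v (Y *\<^sub>v v) = k \<cdot>\<^sub>v v"
    using v X Y by simp
  have "Y *\<^sub>v v \<noteq> 0\<^sub>v n"
  proof
    assume "Y *\<^sub>v v = 0\<^sub>v n"
    moreover have "X *\<^sub>v 0\<^sub>v n = 0\<^sub>v n" using X by (intro eq_vecI) auto
    ultimately have "k \<cdot>\<^sub>v v = 0\<^sub>v n" using XYv by simp
    then have "inverse k \<cdot>\<^sub>v (k \<cdot>\<^sub>v v) = inverse k \<cdot>\<^sub>v 0\<^sub>v n" by simp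
    also have "inverse k \<cdot>\<^sub>v 0\<^sub>v n = 0\<^sub>v n" by (intro eq_vecI) auto
    finally show False using k v(2) by (simp add: smult_smult_assoc)
  qed
  moreover have "(Y * X) *\<^sub>v (Y *\<^sub>v v) = k \<cdot>\<^sub>v (Y *\<^sub>v v)"
    using X Y v XYv by (simp add: mult_mat_vec[of _ n n])
  ultimately show ?thesis
    using X Y v unfolding eigenvalue_def eigenvector_def
    by (intro exI[of _ "Y *\<^sub>v v"]) auto
qed

text \<open>Taking \<open>k\<close> complex lets one computation prove both reality and positivity;
  strictness comes from the injectivity of \<open>transpose_mat B\<close>.\<close>

lemma eigenvalue_gram_pos:
  fixes A :: "real mat"
  defines "B \<equiv> map_mat complex_of_real A"
  assumes A: "A \<in> carrier_mat n n" and det: "det A \<noteq> 0"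
    and ev: "eigenvalue (B * transpose_mat B) k"
  obtains x where "x > 0" "k = complex_of_real x"
proof -
  have B: "B \<in> carrier_mat n n" using A by (simp add: B_def)
  have BT: "transpose_mat B \<in> carrier_mat n n" using B by simp
  obtain v where v: "v \<in> carrier_vec n" "v \<noteq> 0\<^sub>v n" "(B * transpose_mat B) *\<^sub>v v = k \<cdot>\<^sub>v v"
    using ev B unfolding eigenvalue_def eigenvector_def by auto
  define w where "w = transpose_mat B *\<^sub>v v"
  have w: "w \<in> carrier_vec n" unfolding w_def using BT v by auto
  have Bw: "B *\<^sub>v w = k \<cdot>\<^sub>v v"
    unfolding w_def using B BT v by simp
  have "det B \<noteq> 0"
    using det by (simp add: B_def)
  then have "det (transpose_mat B) \<noteq> 0"
    using B by (simp add: det_transpose)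
  then have "w \<noteq> 0\<^sub>v n"
    using det_0_iff_vec_prod_zero[OF BT] v unfolding w_def by blast
  then have wpos: "w \<bullet>c w > 0" using w by simp
  have vpos: "v \<bullet>c v > 0" using v by simp
  \<comment> \<open>The entries of \<open>B\<close> are real, so conjugation passes through
    \<open>transpose_mat B\<close>.\<close>
  have conj_w: "conjugate w = transpose_mat B *\<^sub>v conjugate v"
  proof (rule eq_vecI)
    show "dim_vec (conjugate w) = dim_vec (transpose_mat B *\<^sub>v conjugate v)"
      using w B by simp
    fix i assume "i < dim_vec (transpose_mat B *\<^sub>v conjugate v)"
    then have i: "i < n" using B by simp
    have "conjugate (col B i) = col B i"
      using i A by (intro eq_vecI) (auto simp: B_def)
    moreover have "col B i \<in> carrier_vec n" using B i by auto
    ultimately show "conjugate w $ i = (transpose_mat B *\<^sub>v conjugate v) $ i"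
      using i B w v conjugate_sprod_vec[of "col B i" n v] by (simp add: w_def)
  qed
  \<comment> \<open>With \<open>w = B\<^sup>T v\<close>, the eigenvalue is the Rayleigh quotient \<open>|w|\<^sup>2 / |v|\<^sup>2\<close>.\<close>
  have "w \<bullet>c w = conjugate w \<bullet> w"
    using w by (rule conjugate_vec_sprod_comm) (rule w)
  also have "\<dots> = conjugate v \<bullet> (B *\<^sub>v w)"
    unfolding conj_w using transpose_vec_mult_scalar[OF B w] v by simp
  also have "\<dots> = k * (conjugate v \<bullet> v)"
    unfolding Bw using v by simp
  also have "conjugate v \<bullet> v = v \<bullet>c v"
    using v(1) by (intro conjugate_vec_sprod_comm[symmetric])
  finally have eq: "w \<bullet>c w = k * (v \<bullet>c v)" .
  \<comment> \<open>In the order on complex numbers, being positive includes having zero imaginary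
    part.\<close>
  define a b where "a = Re (w \<bullet>c w)" and "b = Re (v \<bullet>c v)"
  have a: "a > 0" "w \<bullet>c w = of_real a" and b: "b > 0" "v \<bullet>c v = of_real b"
    using wpos vpos by (auto simp: a_def b_def less_complex_def complex_eq_iff)
  from eq a b have "k = of_real (a / b)" by (simp add: field_simps)
  with a b show thesis by (intro that[of "a / b"]) auto
qed

text \<open>The characteristic equation lives over the complex numbers, \<open>lambda_min\<close>
  and \<open>lambda_max\<close> over the reals. Characteristic polynomials match the real
  eigenvalues, and \<open>eigenvalue_gram_pos\<close> rules out any others.\<close>

lemma spectrum_complex_gram:
  fixes A :: "real mat"
  defines "B \<equiv> map_mat complex_of_real A"
  assumes A: "A \<in> carrier_mat n n" and det: "det A \<noteq> 0"
  shows "spectrum (B * transpose_mat B) = complex_of_real ` spectrum (A * transpose_mat A)"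
    and "\<And>x. x \<in> spectrum (A * transpose_mat A) \<Longrightarrow> x > 0"
proof -
  have AA: "A * transpose_mat A \<in> carrier_mat n n" using A by simp
  have BB: "B * transpose_mat B \<in> carrier_mat n n" using A by (simp add: B_def)
  have "B * transpose_mat B = map_mat complex_of_real (A * transpose_mat A)"
    using A by (simp add: B_def map_mat_transpose of_real_hom.mat_hom_mult[of _ n n _ n])
  then have real_ev:
    "complex_of_real x \<in> spectrum (B * transpose_mat B) \<longleftrightarrow> x \<in> spectrum (A * transpose_mat A)" for x
    unfolding spectrum_root_char_poly[OF AA] spectrum_root_char_poly[OF BB]
    by (simp add: of_real_hom.char_poly_hom[OF AA])
  have pos: "\<exists>x>0. k = complex_of_real x" if "k \<in> spectrum (B * transpose_mat B)" for k
    using that eigenvalue_gram_pos[OF A det] unfolding B_def spectrum_def by blast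
  show "spectrum (B * transpose_mat B) = complex_of_real ` spectrum (A * transpose_mat A)"
    using real_ev pos by blast
  show "x > 0" if "x \<in> spectrum (A * transpose_mat A)" for x
    using pos real_ev that by fastforce
qed

text \<open>The complexified matrix has an eigenvalue by algebraic closedness, and it comes from a
  real one.\<close>

lemma spectrum_gram_nonempty:
  fixes A :: "real mat"
  assumes A: "A \<in> carrier_mat n n" and det: "det A \<noteq> 0" and n: "n > 0"
  shows "spectrum (A * transpose_mat A) \<noteq> {}"
proof -
  let ?B = "map_mat complex_of_real A"
  have "?B * transpose_mat ?B \<in> carrier_mat n n" using A by simp
  from spectrum_non_empty[OF this n] show ?thesis
    using spectrum_complex_gram(1)[OF A det] by auto
qed

text \<open>Reconciles the product order in \<open>spectral_norm\<close> with that in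
  \<open>lambda_max\<close>. Swapping factors preserves nonzero eigenvalues, and nonsingularity
  excludes zero.\<close>

lemma spectrum_gram_transpose:
  fixes A :: "real mat"
  assumes A: "A \<in> carrier_mat n n" and det: "det A \<noteq> 0"
  shows "spectrum (transpose_mat A * A) = spectrum (A * transpose_mat A)"
proof -
  have AT: "transpose_mat A \<in> carrier_mat n n" "det (transpose_mat A) \<noteq> 0"
    using A det by (simp_all add: det_transpose)
  have "x \<noteq> 0" if "x \<in> spectrum (A * transpose_mat A) \<union> spectrum (transpose_mat A * A)" for x
    using that spectrum_complex_gram(2)[OF A det, of x] spectrum_complex_gram(2)[OF AT, of x] by auto
  then show ?thesis
    using eigenvalue_mult_commute[OF A AT(1)] eigenvalue_mult_commute[OF AT(1) A]
    unfolding spectrum_def by blast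
qed

section \<open>From the block determinant to the rate\<close>

text \<open>For \<open>b \<noteq> 0\<close>, the reduced matrix is singular exactly when
  \<open>- (a / b)\<^sup>2\<close> is an eigenvalue of \<open>G\<close>; clearing denominators gives
  the quartic.\<close>

lemma ogda_roots_eq:
  fixes A :: "real mat"
  assumes A: "A \<in> carrier_mat n n" and det: "det A \<noteq> 0" and \<eta>: "\<eta> > 0"
  shows "ogda_roots A \<eta> = (\<Union>x\<in>spectrum (A * transpose_mat A).
    {z. (z\<^sup>2 - z)\<^sup>2 + (2 * z - 1)\<^sup>2 * of_real (\<eta>\<^sup>2 * x) = 0})"
proof -
  define B where "B = map_mat complex_of_real A"
  have B: "B \<in> carrier_mat n n" "transpose_mat B \<in> carrier_mat n n" using A by (auto simp: B_def)
  define G where "G = B * transpose_mat B"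
  have G: "G \<in> carrier_mat n n" using B by (simp add: G_def)
  have "det (ogda_matrix A \<eta> z) = 0 \<longleftrightarrow>
    (\<exists>x\<in>spectrum (A * transpose_mat A). (z\<^sup>2 - z)\<^sup>2 + (2 * z - 1)\<^sup>2 * of_real (\<eta>\<^sup>2 * x) = 0)" for z
  proof -
    define a b where "a = z\<^sup>2 - z" and "b = (2 * z - 1) * complex_of_real \<eta>"
    have "ogda_matrix A \<eta> z =
      four_block_mat (a \<cdot>\<^sub>m 1\<^sub>m n) (b \<cdot>\<^sub>m B) ((- b) \<cdot>\<^sub>m transpose_mat B) (a \<cdot>\<^sub>m 1\<^sub>m n)"
      using A by (simp add: ogda_matrix_def Let_def a_def b_def B_def del: minus_diff_eq)
    also have "det \<dots> = det ((a \<cdot>\<^sub>m 1\<^sub>m n) * (a \<cdot>\<^sub>m 1\<^sub>m n) - (b \<cdot>\<^sub>m B) * ((- b) \<cdot>\<^sub>m transpose_mat B))"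
      using B by (intro det_four_block_mat)
        (auto simp: mult_smult_distrib[of _ n n _ n] mult_smult_assoc_mat[of _ n n _ n])
    also have "(a \<cdot>\<^sub>m 1\<^sub>m n) * (a \<cdot>\<^sub>m 1\<^sub>m n) - (b \<cdot>\<^sub>m B) * ((- b) \<cdot>\<^sub>m transpose_mat B)
        = a\<^sup>2 \<cdot>\<^sub>m 1\<^sub>m n + b\<^sup>2 \<cdot>\<^sub>m G"
    proof -
      have 1: "(a \<cdot>\<^sub>m 1\<^sub>m n) * (a \<cdot>\<^sub>m 1\<^sub>m n) = a\<^sup>2 \<cdot>\<^sub>m 1\<^sub>m n"
        by (simp add: mult_smult_assoc_mat[of _ n n _ n], rule eq_matI)
          (auto simp: power2_eq_square)
      have 2: "(b \<cdot>\<^sub>m B) * ((- b) \<cdot>\<^sub>m transpose_mat B) = (- b\<^sup>2) \<cdot>\<^sub>m G"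
        using B G by (simp add: mult_smult_distrib[of _ n n _ n] mult_smult_assoc_mat[of _ n n _ n]
            flip: G_def) (intro eq_matI, auto simp: power2_eq_square)
      show ?thesis unfolding 1 2 using G by (intro eq_matI) auto
    qed
    finally have det_eq: "det (ogda_matrix A \<eta> z) = det (a\<^sup>2 \<cdot>\<^sub>m 1\<^sub>m n + b\<^sup>2 \<cdot>\<^sub>m G)" .
    show ?thesis
    proof (cases "b = 0")
      case True
      \<comment> \<open>Division by \<open>b\<close> fails only at \<open>z = 1 / 2\<close>; there
        \<open>a = - 1 / 4\<close>, so neither the determinant nor any of the quartics
        vanishes.\<close>
      then have "2 * z - 1 = 0" using \<eta> by (simp add: b_def)
      then have z: "z = 1 / 2" by (simp add: field_simps)
      have "a\<^sup>2 \<cdot>\<^sub>m 1\<^sub>m n + b\<^sup>2 \<cdot>\<^sub>m G = a\<^sup>2 \<cdot>\<^sub>m 1\<^sub>m n"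
        using True G by (intro eq_matI) auto
      then have "det (ogda_matrix A \<eta> z) \<noteq> 0"
        unfolding det_eq by (simp add: a_def z power2_eq_square)
      then show ?thesis by (auto simp: z power2_eq_square)
    next
      case False
      have root_iff: "(- (a / b)\<^sup>2 = of_real x) =
        ((z\<^sup>2 - z)\<^sup>2 + (2 * z - 1)\<^sup>2 * of_real (\<eta>\<^sup>2 * x) = 0)" for x
      proof -
        have "- (a / b)\<^sup>2 = of_real x \<longleftrightarrow> a\<^sup>2 + b\<^sup>2 * of_real x = 0"
          using False by (auto simp: power_divide field_simps add_eq_0_iff)
        then show ?thesis by (simp add: a_def b_def power_mult_distrib mult.assoc)
      qed
      have "a\<^sup>2 \<cdot>\<^sub>m 1\<^sub>m n + b\<^sup>2 \<cdot>\<^sub>m G = b\<^sup>2 \<cdot>\<^sub>m char_matrix G (- (a / b)\<^sup>2)"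
        using False G unfolding char_matrix_def
        by (intro eq_matI) (auto simp: power_divide field_simps)
      then have "det (ogda_matrix A \<eta> z) = 0 \<longleftrightarrow> - (a / b)\<^sup>2 \<in> spectrum G"
        unfolding det_eq using False G by (simp add: eigenvalue_det[OF G] spectrum_def)
      also have "\<dots> \<longleftrightarrow> (\<exists>x\<in>spectrum (A * transpose_mat A). - (a / b)\<^sup>2 = of_real x)"
        unfolding G_def B_def spectrum_complex_gram(1)[OF A det] by auto
      finally show ?thesis unfolding root_iff .
    qed
  qed
  then show ?thesis unfolding ogda_roots_def by blast
qed

text \<open>At \<open>1 / 2\<close> the term with \<open>c\<close> drops out and
  \<open>1 / 16\<close> remains, so the polynomial is nonzero whatever \<open>c\<close> is.\<close>

lemma finite_quartic_roots: "finite {z :: complex. (z\<^sup>2 - z)\<^sup>2 + (2 * z - 1)\<^sup>2 * c = 0}"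
proof -
  define p where "p = [:0, -1, 1:]\<^sup>2 + [:c:] * ([:-1, 2:]\<^sup>2)"
  have poly_p: "poly p z = (z\<^sup>2 - z)\<^sup>2 + (2 * z - 1)\<^sup>2 * c" for z
    by (simp add: p_def) (simp add: power2_eq_square algebra_simps)
  have "poly p (1 / 2) \<noteq> 0"
    by (simp add: poly_p power2_eq_square)
  then have "p \<noteq> 0" by auto
  from poly_roots_finite[OF this] show ?thesis by (simp add: poly_p)
qed

text \<open>Each eigenvalue \<open>x\<close> contributes a root of modulus
  \<open>r (\<eta>\<^sup>2 * x)\<close> and none larger; \<open>r_le_max\<close> discards all but
  the extreme ones.\<close>

lemma ogda_rate_eq:
  fixes A :: "real mat"
  assumes A: "A \<in> carrier_mat n n" and det: "det A \<noteq> 0" and n: "n > 0" and \<eta>: "\<eta> > 0"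
  shows "ogda_rate A \<eta> = max (r (\<eta>\<^sup>2 * lambda_min A)) (r (\<eta>\<^sup>2 * lambda_max A))"
proof -
  let ?S = "spectrum (A * transpose_mat A)"
  have fin: "finite ?S" using card_finite_spectrum(1)[of "A * transpose_mat A" n] A by simp
  have ne: "?S \<noteq> {}" by (rule spectrum_gram_nonempty[OF A det n])
  have mem: "lambda_min A \<in> ?S" "lambda_max A \<in> ?S"
    using Min_in[OF fin ne] Max_in[OF fin ne] by (simp_all add: lambda_min_def lambda_max_def)
  have pos: "\<eta>\<^sup>2 * x > 0" if "x \<in> ?S" for x
    using spectrum_complex_gram(2)[OF A det that] \<eta> by simp
  note roots = ogda_roots_eq[OF A det \<eta>]
  have attained: "r (\<eta>\<^sup>2 * x) \<in> cmod ` ogda_roots A \<eta>" if x: "x \<in> ?S" for x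
  proof -
    obtain z :: complex where
      "(z\<^sup>2 - z)\<^sup>2 + (2 * z - 1)\<^sup>2 * of_real (\<eta>\<^sup>2 * x) = 0" "cmod z = r (\<eta>\<^sup>2 * x)"
      using quartic_root_attained[OF pos[OF x]] by blast
    then show ?thesis using x unfolding roots by (intro image_eqI[of _ _ z]) auto
  qed
  show ?thesis unfolding ogda_rate_def
  proof (rule Max_eqI)
    show "finite (cmod ` ogda_roots A \<eta>)"
      unfolding roots using fin finite_quartic_roots by blast
    show "max (r (\<eta>\<^sup>2 * lambda_min A)) (r (\<eta>\<^sup>2 * lambda_max A)) \<in> cmod ` ogda_roots A \<eta>"
      using attained mem by (simp add: max_def)
    fix y assume "y \<in> cmod ` ogda_roots A \<eta>"
    then obtain z x where z: "y = cmod z" "x \<in> ?S"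
      "(z\<^sup>2 - z)\<^sup>2 + (2 * z - 1)\<^sup>2 * of_real (\<eta>\<^sup>2 * x) = 0"
      unfolding roots by blast
    have "lambda_min A \<le> x" "x \<le> lambda_max A"
      using fin z(2) by (simp_all add: lambda_min_def lambda_max_def)
    then have "r (\<eta>\<^sup>2 * x) \<le> max (r (\<eta>\<^sup>2 * lambda_min A)) (r (\<eta>\<^sup>2 * lambda_max A))"
      by (intro r_le_max mult_left_mono) auto
    with quartic_root_bound[OF pos[OF z(2)] z(3)] z(1)
    show "y \<le> max (r (\<eta>\<^sup>2 * lambda_min A)) (r (\<eta>\<^sup>2 * lambda_max A))" by linarith
  qed
qed

section \<open>The optimal learning rate\<close>

text \<open>The intermediate value theorem is applied to the difference \<open>g\<close>, with
  \<open>t\<close> standing for \<open>\<eta>\<^sup>2\<close>.\<close>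

lemma balanced_rate_exists:
  assumes "0 < m" "m \<le> M"
  obtains \<eta> where "\<eta> > 0" "r (\<eta>\<^sup>2 * m) = r (\<eta>\<^sup>2 * M)" "\<eta>\<^sup>2 * m \<le> 1 / 4" "1 / 4 \<le> \<eta>\<^sup>2 * M"
proof -
  define g where "g t = r (t * M) - r (t * m)" for t
  \<comment> \<open>At \<open>a\<close> the larger eigenvalue lands on the minimum point
    \<open>1 / 4\<close> of \<open>r\<close>, at \<open>b\<close> the smaller one does; hence
    \<open>g a \<le> 0 \<le> g b\<close>.\<close>
  define a b where "a = 1 / (4 * M)" and "b = 1 / (4 * m)"
  have ab: "0 < a" "a \<le> b" "a * M = 1 / 4" "b * m = 1 / 4"
    using assms by (simp_all add: a_def b_def frac_le)
  have "a * m \<le> a * M" "b * m \<le> b * M"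
    using assms ab by (auto intro: mult_left_mono)
  then have "a * m \<le> 1 / 4" "1 / 4 \<le> b * M"
    using ab by auto
  then have "g a \<le> 0" "0 \<le> g b"
    using r_strict_antimono[of "a * m" "1 / 4"] r_strict_mono[of "1 / 4" "b * M"]
    unfolding g_def ab(3,4) diff_le_0_iff_le diff_ge_0_iff_ge by (metis le_less)+
  moreover have "continuous_on {a..b} g"
    unfolding g_def
    by (intro continuous_intros continuous_on_compose2[OF continuous_on_r]) auto
  ultimately obtain t where t: "a \<le> t" "t \<le> b" "g t = 0"
    using IVT'[of g a 0 b] ab by auto
  have "t * m \<le> b * m" "a * M \<le> t * M"
    using t assms by (auto intro: mult_right_mono)
  then have "t * m \<le> 1 / 4" "1 / 4 \<le> t * M"
    unfolding ab(3,4) by auto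
  with t ab show thesis by (intro that[of "sqrt t"]) (auto simp: g_def)
qed

text \<open>A smaller rate pushes \<open>e\<^sup>2 * m\<close> further left of \<open>1 / 4\<close>,
  a larger one pushes \<open>e\<^sup>2 * M\<close> further right; either way one term exceeds the
  common balanced value.\<close>

lemma max_r_unique_min:
  assumes m: "0 < m" "m \<le> M" and \<eta>: "\<eta> > 0" and e: "e > 0" "e \<noteq> \<eta>"
    and bal: "r (\<eta>\<^sup>2 * m) = r (\<eta>\<^sup>2 * M)" "\<eta>\<^sup>2 * m \<le> 1 / 4" "1 / 4 \<le> \<eta>\<^sup>2 * M"
  shows "max (r (\<eta>\<^sup>2 * m)) (r (\<eta>\<^sup>2 * M)) < max (r (e\<^sup>2 * m)) (r (e\<^sup>2 * M))"
proof (cases "e < \<eta>")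
  case True
  then have "e\<^sup>2 * m < \<eta>\<^sup>2 * m"
    using e m by (intro mult_strict_right_mono power_strict_mono) auto
  then have "r (\<eta>\<^sup>2 * m) < r (e\<^sup>2 * m)" using bal by (intro r_strict_antimono)
  then show ?thesis using bal by simp
next
  case False
  then have "\<eta>\<^sup>2 * M < e\<^sup>2 * M"
    using e m \<eta> by (intro mult_strict_right_mono power_strict_mono) auto
  then have "r (\<eta>\<^sup>2 * M) < r (e\<^sup>2 * M)" using bal by (intro r_strict_mono)
  then show ?thesis using bal by simp
qed

text \<open>Strict monotonicity on each side of \<open>1 / 4\<close> forbids two equal values on the
  same side.\<close>

lemma r_eq_imp_straddle:
  assumes "x < y" "r x = r y"
  shows "x < 1 / 4" "1 / 4 < y"
  using r_strict_antimono[of x y] r_strict_mono[of x y] assms by linarith+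

text \<open>The balanced rate is the witness in both cases. When the extreme eigenvalues coincide,
  balance is automatic and the bounds around \<open>1 / 4\<close> alone fix the rate.\<close>

theorem mainTheorem6:
  fixes A :: "real mat" and n :: nat
  assumes "n > 0" and "A \<in> carrier_mat n n" and "invertible_mat A"
  shows "\<exists>\<eta>opt > 0.
    (\<forall>\<eta>. is_arg_min (ogda_rate A) (\<lambda>\<eta>. \<eta> > 0) \<eta> \<longleftrightarrow> \<eta> = \<eta>opt) \<and>
    (lambda_min A = lambda_max A \<longrightarrow>
       \<eta>opt = 1 / (2 * sqrt (lambda_max A)) \<and>
       1 / (2 * sqrt (lambda_max A)) = 1 / (2 * spectral_norm A)) \<and>
    (lambda_min A \<noteq> lambda_max A \<longrightarrow>
       (\<forall>\<eta> > 0. r (\<eta>\<^sup>2 * lambda_min A) = r (\<eta>\<^sup>2 * lambda_max A) \<longleftrightarrow> \<eta> = \<eta>opt) \<and>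
       \<eta>opt\<^sup>2 * lambda_min A < 1 / 4 \<and> 1 / 4 < \<eta>opt\<^sup>2 * lambda_max A)"
proof -
  define m M where "m = lambda_min A" and "M = lambda_max A"
  let ?S = "spectrum (A * transpose_mat A)"
  have A: "A \<in> carrier_mat n n" and det: "det A \<noteq> 0"
    using assms invertible_mat_det_nonzero by auto
  have fin: "finite ?S" using card_finite_spectrum(1)[of "A * transpose_mat A" n] A by simp
  have ne: "?S \<noteq> {}" by (rule spectrum_gram_nonempty[OF A det assms(1)])
  have mem: "m \<in> ?S"
    using Min_in[OF fin ne] by (simp add: m_def lambda_min_def)
  have m: "0 < m" using spectrum_complex_gram(2)[OF A det mem] .
  have mM: "m \<le> M"
    using mem fin by (simp add: M_def lambda_max_def)
  obtain \<eta> where \<eta>: "\<eta> > 0" "r (\<eta>\<^sup>2 * m) = r (\<eta>\<^sup>2 * M)" "\<eta>\<^sup>2 * m \<le> 1 / 4" "1 / 4 \<le> \<eta>\<^sup>2 * M"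
    using balanced_rate_exists[OF m mM] .
  have less: "ogda_rate A \<eta> < ogda_rate A e" if "e > 0" "e \<noteq> \<eta>" for e
    using max_r_unique_min[OF m mM \<eta>(1) that \<eta>(2-4)]
    by (simp add: ogda_rate_eq[OF A det assms(1)] that \<eta>(1) m_def M_def)
  have norm: "spectral_norm A = sqrt M"
    by (simp add: spectral_norm_def M_def lambda_max_def spectrum_gram_transpose[OF A det])
  have arg_min: "is_arg_min (ogda_rate A) (\<lambda>\<eta>. \<eta> > 0) e \<longleftrightarrow> e = \<eta>" for e
    using less \<eta>(1) unfolding is_arg_min_def by (metis less_asym)
  have eq_case: "\<eta> = 1 / (2 * sqrt M)" if "m = M"
  proof -
    \<comment> \<open>With \<open>m = M\<close>, the two bounds force
      \<open>\<eta>\<^sup>2 * M = 1 / 4\<close>.\<close>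
    have "\<eta>\<^sup>2 = 1 / (4 * M)" using \<eta> that m by (simp add: field_simps)
    then have "\<eta> = sqrt (1 / (4 * M))" using \<eta>(1) by (metis less_imp_le real_sqrt_unique)
    then show ?thesis by (simp add: real_sqrt_divide real_sqrt_mult)
  qed
  have unique: "e = \<eta>" if ne: "m \<noteq> M" and e: "e > 0" "r (e\<^sup>2 * m) = r (e\<^sup>2 * M)" for e
  proof (rule ccontr)
    assume "e \<noteq> \<eta>"
    have "e\<^sup>2 * m < e\<^sup>2 * M" using ne mM e(1) by simp
    from r_eq_imp_straddle[OF this e(2)] have "e\<^sup>2 * m \<le> 1 / 4" "1 / 4 \<le> e\<^sup>2 * M" by auto
    \<comment> \<open>Two distinct balanced rates would each give a strictly smaller maximum than
      the other.\<close>
    from max_r_unique_min[OF m mM e(1) \<eta>(1) \<open>e \<noteq> \<eta>\<close>[symmetric] e(2) this]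
      max_r_unique_min[OF m mM \<eta>(1) e(1) \<open>e \<noteq> \<eta>\<close> \<eta>(2-4)]
    show False by (rule less_asym)
  qed
  have straddle: "\<eta>\<^sup>2 * m < 1 / 4" "1 / 4 < \<eta>\<^sup>2 * M" if "m \<noteq> M"
    using r_eq_imp_straddle[OF _ \<eta>(2)] that mM \<eta>(1) by simp_all
  show ?thesis
    unfolding m_def[symmetric] M_def[symmetric] norm
  proof (intro exI[of _ \<eta>] conjI allI impI)
    fix e :: real assume "m \<noteq> M" "e > 0"
    then show "r (e\<^sup>2 * m) = r (e\<^sup>2 * M) \<longleftrightarrow> e = \<eta>"
      using unique \<eta>(2) by blast
  qed (use \<eta>(1) arg_min eq_case straddle in blast)+
qed

end
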